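(* For every integer $n\geq 3$ there exists a word $u_1u_2\dots u_{n!}$ of length $n!$ over the alphabet $\{0,1,2,\dots,n\}$ such that each element of $S_n$ is order-isomorphic to exactly one of the $n!$ cyclic intervals $u_{i+1}u_{i+2}\dots u_{i+n}$ ($0\leq i\leq n!-1$) of length $n$ of the word.
   Context: $S_n$ is regarded as the set of all $n$-tuples $a_1a_2\dots a_n$ of distinct elements of $[n]=\{1,2,\dots,n\}$. Two $n$-tuples of distinct integers $a=a_1a_2\dots a_n$ and $b=b_1b_2\dots b_n$ are order-isomorphic if $a_i<a_j \Leftrightarrow b_i<b_j$ for all $1\leq i,j\leq n$. For a word $u_1u_2\dots u_N$ of length $N=n!$, the cyclic intervals of length $n$ are the $N$ words $u_{i+1}u_{i+2}\dots u_{i+n}$, one for each starting position $i\in\{0,1,\dots,N-1\}$, with index addition interpreted modulo $N$ (indices taken in $\{1,\dots,N\}$); intervals are counted by starting position. *)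

theory Defs
  imports Complex_Main
begin

definition perm_tuples :: "nat \<Rightarrow> nat list set" where
  "perm_tuples n = {a. length a = n \<and> distinct a \<and> set a \<subseteq> {1..n}}"

text \<open>Order-isomorphism is a relation between tuples of distinct entries only, so a tuple with
  a repeated entry is order-isomorphic to nothing.\<close>

definition order_isomorphic :: "nat list \<Rightarrow> nat list \<Rightarrow> bool" where
  "order_isomorphic a b \<longleftrightarrow>
     length a = length b \<and> distinct a \<and> distinct b \<and>
     (\<forall>i<length a. \<forall>j<length a. a ! i < a ! j \<longleftrightarrow> b ! i < b ! j)"

text \<open>Lists are indexed from 0, so the letter $u_k$ of a word is \<open>u ! (k - 1)\<close>, and the interval
  $u_{i+1} u_{i+2} \dots u_{i+n}$ consists of the entries of \<open>u\<close> at the positions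
  \<open>i, \<dots>, i + n - 1\<close>, taken modulo the length of \<open>u\<close>.\<close>

definition cyclic_interval :: "nat \<Rightarrow> nat list \<Rightarrow> nat \<Rightarrow> nat list" where
  "cyclic_interval n u i = map (\<lambda>j. u ! ((i + j) mod length u)) [0..<n]"

end

theory Submission
  imports Defs "Graph_Theory.Euler" "HOL-Combinatorics.Transposition"
begin

text \<open>
  Consider the digraph whose vertices are \<open>(n - 1)\<close>-tuples and whose arcs are \<open>n\<close>-tuples, an arc
  leading from its first \<open>n - 1\<close> letters to its last \<open>n - 1\<close> letters. A universal cycle is an
  Eulerian circuit through a set of arcs over \<open>{0..n}\<close> that represents every order type once. Take
  one cyclic word for every cyclic order type, where we may choose which of the \<open>n + 1\<close> letters to
  leave out, and all its rotations as arcs; then the digraph is balanced. It is connected if any two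
  of the cyclic words are joined by a chain in which a letter is replaced by the missing one.

  With the letter 0 at place 0, and \<open>m = n - 1\<close>, listing the other places in the order of their
  letters turns this into the following problem: insert a star into every permutation of \<open>{1..m}\<close>
  so that the resulting words are connected under swapping the star with an arbitrary symbol. For
  \<open>m \<ge> 4\<close> this is solved by induction: append each \<open>i \<le> m + 1\<close> to a copy of the solution for \<open>m\<close> in
  which the symbols are renamed, and link the copies by moving the star to the end in three
  words. There is no solution for \<open>m = 3\<close>, so \<open>n = 4\<close> needs an explicit word.
\<close>

section \<open>Order types\<close>

text \<open>The standardization of a word. Counting with \<open>\<le>\<close> makes ranks start at
  1, so that values land in \<open>perm_tuples\<close>.\<close>

definition rank_list :: "nat list \<Rightarrow> nat list" where
  "rank_list w = map (\<lambda>x. length (filter (\<lambda>y. y \<le> x) w)) w"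

lemma rank_less_iff:
  fixes w :: "nat list"
  assumes "x \<in> set w" "y \<in> set w"
  shows "length (filter (\<lambda>z. z \<le> x) w) < length (filter (\<lambda>z. z \<le> y) w) \<longleftrightarrow> x < y"
proof
  assume "x < y"
  have "length (filter (\<lambda>z. z \<le> x) w) = length (filter (\<lambda>z. z \<le> x) (filter (\<lambda>z. z \<le> y) w))"
    using \<open>x < y\<close> by (auto simp: intro!: arg_cong[where f = length] filter_cong)
  also have "\<dots> < length (filter (\<lambda>z. z \<le> y) w)"
    using assms \<open>x < y\<close> by (intro length_filter_less[of y]) auto
  finally show "length (filter (\<lambda>z. z \<le> x) w) < length (filter (\<lambda>z. z \<le> y) w)" .
next
  assume less: "length (filter (\<lambda>z. z \<le> x) w) < length (filter (\<lambda>z. z \<le> y) w)"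
  show "x < y"
  proof (rule ccontr)
    assume "\<not> x < y"
    then have "filter (\<lambda>z. z \<le> y) w = filter (\<lambda>z. z \<le> y) (filter (\<lambda>z. z \<le> x) w)"
      by (auto intro!: filter_cong)
    then have "length (filter (\<lambda>z. z \<le> y) w) \<le> length (filter (\<lambda>z. z \<le> x) w)"
      by (metis length_filter_le)
    with less show False by simp
  qed
qed

lemma order_isomorphic_rank_list:
  assumes "distinct w"
  shows "order_isomorphic w (rank_list w)"
proof -
  have less: "w ! i < w ! j \<longleftrightarrow> rank_list w ! i < rank_list w ! j"
    if "i < length w" "j < length w" for i j
    using that by (simp add: rank_list_def rank_less_iff)
  have "distinct (rank_list w)"
    unfolding distinct_conv_nth
  proof (intro allI impI)
    fix i j assume ij: "i < length (rank_list w)" "j < length (rank_list w)" "i \<noteq> j"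
    then have "i < length w" "j < length w" by (auto simp: rank_list_def)
    moreover have "w ! i \<noteq> w ! j" using assms ij by (simp add: nth_eq_iff_index_eq rank_list_def)
    ultimately show "rank_list w ! i \<noteq> rank_list w ! j"
      using less by (metis nat_neq_iff)
  qed
  with assms less show ?thesis by (simp add: order_isomorphic_def) (simp add: rank_list_def)
qed

text \<open>A rank counts the indices with entry at most the given one, and that index set depends
  only on the order relation. Thus \<open>rank_list\<close> is a complete invariant of order
  types.\<close>

lemma rank_list_eqI:
  assumes "order_isomorphic a b"
  shows "rank_list a = rank_list b"
proof (rule nth_equalityI)
  show "length (rank_list a) = length (rank_list b)"
    using assms by (simp add: rank_list_def order_isomorphic_def)
  fix i assume "i < length (rank_list a)"
  then have i: "i < length a" "i < length b"
    using assms by (simp_all add: rank_list_def order_isomorphic_def)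
  have "{j. j < length a \<and> a ! j \<le> a ! i} = {j. j < length b \<and> b ! j \<le> b ! i}"
    using assms i by (auto simp: order_isomorphic_def simp flip: not_less)
  with i show "rank_list a ! i = rank_list b ! i"
    by (simp add: rank_list_def length_filter_conv_card)
qed

lemma rank_list_in_perm_tuples:
  assumes "distinct w"
  shows "rank_list w \<in> perm_tuples (length w)"
proof -
  have "1 \<le> length (filter (\<lambda>y. y \<le> x) w)" if "x \<in> set w" for x
    using that length_pos_if_in_set[of x "filter (\<lambda>y. y \<le> x) w"] by (simp add: Suc_le_eq)
  then have "set (rank_list w) \<subseteq> {1..length w}"
    by (auto simp: rank_list_def)
  moreover have "distinct (rank_list w)"
    using order_isomorphic_rank_list[OF assms] by (simp add: order_isomorphic_def)
  ultimately show ?thesis by (simp add: perm_tuples_def rank_list_def)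
qed

lemma order_isomorphic_sym: "order_isomorphic a b \<Longrightarrow> order_isomorphic b a"
  by (auto simp: order_isomorphic_def)

lemma order_isomorphic_trans:
  "order_isomorphic a b \<Longrightarrow> order_isomorphic b c \<Longrightarrow> order_isomorphic a c"
  by (auto simp: order_isomorphic_def)

text \<open>Distinctness forces \<open>a\<close> to use every letter of \<open>{1..n}\<close>, so
  exactly x of its entries are at most x.\<close>

lemma rank_list_perm_tuple:
  assumes "a \<in> perm_tuples n"
  shows "rank_list a = a"
proof -
  have "length a = n" and "distinct a" and sub: "set a \<subseteq> {1..n}"
    using assms by (auto simp: perm_tuples_def)
  then have eq: "set a = {1..n}"
    by (intro card_subset_eq) (auto simp: distinct_card)
  have "length (filter (\<lambda>y. y \<le> x) a) = x" if "x \<in> set a" for x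
  proof -
    have "length (filter (\<lambda>y. y \<le> x) a) = card (set (filter (\<lambda>y. y \<le> x) a))"
      using \<open>distinct a\<close> by (intro distinct_card[symmetric] distinct_filter)
    also have "set (filter (\<lambda>y. y \<le> x) a) = {1..x}"
      using that eq by auto
    finally show ?thesis by simp
  qed
  then show ?thesis unfolding rank_list_def by (rule map_idI)
qed

section \<open>Counting order types, and the cases n = 3 and n = 4\<close>

lemma card_perm_tuples: "finite (perm_tuples n)" "card (perm_tuples n) = fact n"
proof -
  have eq: "perm_tuples n = {xs. length xs = n \<and> distinct xs \<and> set xs \<subseteq> {1..n}}"
    by (simp add: perm_tuples_def)
  show "finite (perm_tuples n)"
    by (rule finite_subset[OF _ finite_lists_length_eq[of "{1..n}" n]]) (auto simp: perm_tuples_def)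
  show "card (perm_tuples n) = fact n"
    unfolding eq by (subst card_lists_distinct_length_eq) (auto simp: fact_prod)
qed

text \<open>There are as many intervals as permutations, so injectivity of the standardized
  intervals already makes them a bijection onto \<open>perm_tuples n\<close>.\<close>

lemma universal_cycleI:
  assumes len: "length u = fact n" and alphabet: "set u \<subseteq> {0..n}"
    and dist: "\<And>i. i < fact n \<Longrightarrow> distinct (cyclic_interval n u i)"
    and inj: "inj_on (\<lambda>i. rank_list (cyclic_interval n u i)) {..<fact n}"
  shows "\<exists>u :: nat list. length u = fact n \<and> set u \<subseteq> {0..n} \<and>
           (\<forall>a \<in> perm_tuples n. \<exists>!i. i < fact n \<and> order_isomorphic a (cyclic_interval n u i))"
proof -
  let ?r = "\<lambda>i. rank_list (cyclic_interval n u i)"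
  have "?r i \<in> perm_tuples n" if "i < fact n" for i
    using rank_list_in_perm_tuples[OF dist[OF that]] by (simp add: cyclic_interval_def)
  then have "?r ` {..<fact n} \<subseteq> perm_tuples n" by blast
  moreover have "card (?r ` {..<fact n}) = card (perm_tuples n)"
    unfolding card_image[OF inj] card_perm_tuples by (rule card_lessThan)
  ultimately have onto: "?r ` {..<fact n} = perm_tuples n"
    by (rule card_subset_eq[OF card_perm_tuples(1)])
  have "\<exists>!i. i < fact n \<and> order_isomorphic a (cyclic_interval n u i)" if a: "a \<in> perm_tuples n" for a
  proof -
    obtain i where i: "i < fact n" "?r i = a" using a unfolding onto[symmetric] by auto
    have uniq: "j = i" if "j < fact n" "order_isomorphic a (cyclic_interval n u j)" for j
    proof -
      have "?r j = ?r i"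
        using rank_list_eqI[OF that(2)] rank_list_perm_tuple[OF a] i(2) by simp
      with inj_onD[OF inj] i(1) that(1) show ?thesis by simp
    qed
    have iso: "order_isomorphic a (cyclic_interval n u i)"
      using order_isomorphic_sym[OF order_isomorphic_rank_list[OF dist[OF i(1)]]] i(2) by simp
    show ?thesis
      by (rule ex1I[of _ i]) (use i(1) iso uniq in blast)+
  qed
  with len alphabet show ?thesis by (intro exI[of _ u] conjI) simp_all
qed

text \<open>An executable form of the criterion, by which concrete words are checked by
  evaluation.\<close>

lemma universal_cycle_listI:
  assumes "length u = fact n" and "set u \<subseteq> {0..n}"
    and "list_all (\<lambda>i. distinct (cyclic_interval n u i)) [0..<fact n]"
    and "distinct (map (\<lambda>i. rank_list (cyclic_interval n u i)) [0..<fact n])"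
  shows "\<exists>u :: nat list. length u = fact n \<and> set u \<subseteq> {0..n} \<and>
           (\<forall>a \<in> perm_tuples n. \<exists>!i. i < fact n \<and> order_isomorphic a (cyclic_interval n u i))"
  using assms by (intro universal_cycleI[of u]) (auto simp: list_all_iff distinct_map atLeast0LessThan)

lemma universal_cycle_3:
  "\<exists>u :: nat list. length u = fact 3 \<and> set u \<subseteq> {0..3} \<and>
     (\<forall>a \<in> perm_tuples 3. \<exists>!i. i < fact 3 \<and> order_isomorphic a (cyclic_interval 3 u i))"
  by (rule universal_cycle_listI[of "[1, 2, 3, 1, 0, 3]"]) code_simp+

lemma universal_cycle_4:
  "\<exists>u :: nat list. length u = fact 4 \<and> set u \<subseteq> {0..4} \<and>
     (\<forall>a \<in> perm_tuples 4. \<exists>!i. i < fact 4 \<and> order_isomorphic a (cyclic_interval 4 u i))"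
  by (rule universal_cycle_listI[of "[1, 2, 3, 4, 0, 2, 1, 3, 0, 2, 4, 1, 0, 2, 4, 3, 1, 0, 4, 3, 1, 2, 0, 4]"])
    code_simp+

section \<open>Eulerian circuits\<close>

lemma (in pre_digraph) cas_consecutive:
  "cas u p v \<Longrightarrow> Suc i < length p \<Longrightarrow> head G (p ! i) = tail G (p ! Suc i)"
proof (induction p arbitrary: u i)
  case (Cons e es)
  then have "cas (head G e) es v" by simp
  with Cons show ?case by (cases i; cases es) auto
qed simp

lemma (in pre_digraph) cas_closes:
  "cas u p v \<Longrightarrow> p \<noteq> [] \<Longrightarrow> tail G (p ! 0) = u \<and> head G (p ! (length p - 1)) = v"
proof (induction p arbitrary: u)
  case (Cons e es)
  then show ?case by (cases "es = []") (auto simp: nth_Cons')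
qed simp

text \<open>Since \<open>butlast (rotate1 e) = tl e\<close>, rotation is a bijection from the arcs
  entering a vertex to the arcs leaving it. Closure under rotation therefore gives balance, and
  Euler's theorem applies.\<close>

lemma eulerian_cyclic_word:
  fixes A :: "'a list set"
  assumes fin: "finite A" and ne: "A \<noteq> {}"
    and len: "\<And>e. e \<in> A \<Longrightarrow> length e = n" and n: "n > 0"
    and rot: "\<And>e. e \<in> A \<Longrightarrow> rotate1 e \<in> A"
    and conn: "\<And>e f. e \<in> A \<Longrightarrow> f \<in> A \<Longrightarrow> (e, f) \<in> {(e, f) \<in> A \<times> A. tl e = butlast f}\<^sup>*"
  shows "\<exists>p. distinct p \<and> set p = A \<and>
           (\<forall>i<length p. tl (p ! i) = butlast (p ! ((i + 1) mod length p)))"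
proof -
  have not_Nil: "e \<noteq> []" if "e \<in> A" for e using len[OF that] n by auto
  have butlast_rot: "butlast (rotate1 e) = tl e" for e :: "'a list" by (cases e) auto
  define G where "G = \<lparr>verts = butlast ` A, arcs = A, tail = butlast, head = tl :: 'a list \<Rightarrow> 'a list\<rparr>"
  have G[simp]: "verts G = butlast ` A" "arcs G = A" "tail G = butlast" "head G = tl"
    by (simp_all add: G_def)
  interpret fin_digraph G
  proof
    show "head G e \<in> verts G" if "e \<in> arcs G" for e
      using that rot butlast_rot[of e] by (metis G image_eqI)
  qed (use fin in auto)
  have reach: "butlast e \<rightarrow>\<^sup>*\<^bsub>G\<^esub> butlast f" if "e \<in> A" "f \<in> A" for e f
    using conn[OF that]
  proof (induction rule: rtrancl_induct)
    case base
    then show ?case using that by (intro reachable_refl) simp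
  next
    case (step f g)
    then have "butlast f \<rightarrow>\<^bsub>G\<^esub> butlast g"
      by (auto simp: arcs_ends_def arc_to_ends_def)
    with step.IH show ?case by (meson reachable_adj_trans)
  qed
  have "connected G"
    unfolding connected_def strongly_connected_def
    using ne reach by (auto intro!: reachable_mk_symmetricI)
  moreover have "in_degree G u = out_degree G u" for u
  proof -
    have surj: "rotate1 ` A = A"
      using rot by (intro endo_inj_surj fin inj_on_subset[OF inj_rotate1]) auto
    have "rotate1 ` in_arcs G u = out_arcs G u"
    proof
      show "rotate1 ` in_arcs G u \<subseteq> out_arcs G u"
        using rot by (auto simp: in_arcs_def out_arcs_def butlast_rot)
      show "out_arcs G u \<subseteq> rotate1 ` in_arcs G u"
      proof
        fix f assume f: "f \<in> out_arcs G u"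
        then obtain e where "e \<in> A" "f = rotate1 e"
          using surj by (auto simp: out_arcs_def)
        with f show "f \<in> rotate1 ` in_arcs G u"
          by (auto simp: in_arcs_def out_arcs_def butlast_rot)
      qed
    qed
    moreover have "inj_on rotate1 (in_arcs G u)" by (rule inj_on_subset[OF inj_rotate1], simp)
    ultimately show ?thesis
      unfolding in_degree_def out_degree_def by (metis card_image)
  qed
  ultimately obtain u p where "euler_trail u p u" using closed_euler by blast
  then have cas: "cas u p u" and p: "distinct p" "set p = A"
    by (auto simp: euler_trail_def trail_def awalk_def)
  have "tl (p ! i) = butlast (p ! ((i + 1) mod length p))" if "i < length p" for i
  proof (cases "i + 1 < length p")
    case True
    then show ?thesis using cas_consecutive[OF cas, of i] by simp
  next
    case False
    then have "i = length p - 1" "p \<noteq> []" using that by auto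
    then show ?thesis using cas_closes[OF cas] by simp
  qed
  with p show ?thesis by blast
qed

text \<open>Passing to the next arc drops the first letter, so letter j of an arc is the first
  letter of the arc j steps later. The first letters along the circuit hence spell a word whose
  intervals are the arcs.\<close>

lemma cyclic_interval_map_hd:
  assumes len: "\<And>e. e \<in> set p \<Longrightarrow> length e = n"
    and step: "\<And>i. i < length p \<Longrightarrow> tl (p ! i) = butlast (p ! ((i + 1) mod length p))"
    and i: "i < length p"
  shows "cyclic_interval n (map hd p) i = p ! i"
proof (rule nth_equalityI)
  show "length (cyclic_interval n (map hd p) i) = length (p ! i)"
    using i len by (simp add: cyclic_interval_def)
  have key: "p ! i ! j = hd (p ! ((i + j) mod length p))" if "i < length p" "j < n" for i j
    using that
  proof (induction j arbitrary: i)
    case 0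
    then have "p ! i \<noteq> []" using len by (metis length_greater_0_conv nth_mem)
    with 0 show ?case by (simp add: hd_conv_nth)
  next
    case (Suc j)
    let ?k = "(i + 1) mod length p"
    have k: "?k < length p" using Suc.prems by (intro mod_less_divisor) auto
    have "p ! i ! Suc j = tl (p ! i) ! j"
      using Suc.prems len[of "p ! i"] by (simp add: nth_tl)
    also have "\<dots> = p ! ?k ! j"
      using Suc.prems step[of i] len[of "p ! ?k"] k by (simp add: nth_butlast)
    also have "\<dots> = hd (p ! ((?k + j) mod length p))"
      using Suc.IH[OF k] Suc.prems by simp
    also have "(?k + j) mod length p = (i + Suc j) mod length p"
      by (simp add: mod_simps)
    finally show ?case .
  qed
  fix j assume "j < length (cyclic_interval n (map hd p) i)"
  then have "j < n" by (simp add: cyclic_interval_def)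
  moreover have "(i + j) mod length p < length p" using i by (intro mod_less_divisor) auto
  ultimately show "cyclic_interval n (map hd p) i ! j = p ! i ! j"
    using key[OF i] by (simp add: cyclic_interval_def)
qed

lemma universal_cycle_from_arcs:
  fixes A :: "nat list set"
  assumes card: "card A = fact n" and n: "n > 0"
    and len: "\<And>e. e \<in> A \<Longrightarrow> length e = n"
    and dist: "\<And>e. e \<in> A \<Longrightarrow> distinct e"
    and alphabet: "\<And>e. e \<in> A \<Longrightarrow> set e \<subseteq> {0..n}"
    and rot: "\<And>e. e \<in> A \<Longrightarrow> rotate1 e \<in> A"
    and conn: "\<And>e f. e \<in> A \<Longrightarrow> f \<in> A \<Longrightarrow> (e, f) \<in> {(e, f) \<in> A \<times> A. tl e = butlast f}\<^sup>*"
    and inj: "inj_on rank_list A"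
  shows "\<exists>u :: nat list. length u = fact n \<and> set u \<subseteq> {0..n} \<and>
           (\<forall>a \<in> perm_tuples n. \<exists>!i. i < fact n \<and> order_isomorphic a (cyclic_interval n u i))"
proof -
  have "finite A" "A \<noteq> {}" using card by (auto intro: card_ge_0_finite)
  then obtain p where p: "distinct p" "set p = A"
    and step: "\<And>i. i < length p \<Longrightarrow> tl (p ! i) = butlast (p ! ((i + 1) mod length p))"
    using eulerian_cyclic_word[OF _ _ len n rot conn] by blast
  have N: "length p = fact n" using p card distinct_card by fastforce
  have window: "cyclic_interval n (map hd p) i = p ! i" if "i < fact n" for i
    using that N p len step by (intro cyclic_interval_map_hd) auto
  have mem: "p ! i \<in> A" if "i < fact n" for i using that N p by auto
  show ?thesis
  proof (rule universal_cycleI[of "map hd p"])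
    show "length (map hd p) = fact n" using N by simp
    show "set (map hd p) \<subseteq> {0..n}"
    proof
      fix x assume "x \<in> set (map hd p)"
      then obtain e where e: "e \<in> A" "x = hd e" using p by auto
      then have "x \<in> set e" using len n by (metis hd_in_set length_greater_0_conv)
      then show "x \<in> {0..n}" using alphabet e(1) by blast
    qed
    show "distinct (cyclic_interval n (map hd p) i)" if "i < fact n" for i
      using window[OF that] mem[OF that] dist by simp
    show "inj_on (\<lambda>i. rank_list (cyclic_interval n (map hd p) i)) {..<fact n}"
    proof (rule inj_onI)
      fix i j assume ij: "i \<in> {..<fact n}" "j \<in> {..<fact n}"
        and "rank_list (cyclic_interval n (map hd p) i) = rank_list (cyclic_interval n (map hd p) j)"
      then have "p ! i = p ! j" using window mem inj by (auto dest: inj_onD)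
      then show "i = j" using ij p(1) N by (simp add: nth_eq_iff_index_eq)
    qed
  qed
qed

section \<open>Star words\<close>

text \<open>Star words encode the cyclic order types: the symbol \<open>p > 0\<close> stands for the place \<open>p\<close> of a
  cyclic word, and its index is the letter at that place (shifted by one, because the letter 0 is
  kept at place 0). The symbol 0, the star, marks the letter that does not occur.\<close>

abbreviation swap :: "nat \<Rightarrow> nat \<Rightarrow> nat \<Rightarrow> nat" where
  "swap \<equiv> Transposition.transpose"

definition star_word :: "nat \<Rightarrow> nat list \<Rightarrow> bool" where
  "star_word m W \<longleftrightarrow> distinct W \<and> set W = {0..m}"

text \<open>In terms of tuples, place \<open>a\<close> receives the missing letter and its old
  letter becomes the missing one.\<close>

definition star_step :: "(nat list \<times> nat list) set" where
  "star_step = {(W, map (swap 0 a) W) | W a. {0, a} \<subseteq> set W}"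

definition linked :: "nat list set \<Rightarrow> bool" where
  "linked S \<longleftrightarrow> (\<forall>x\<in>S. \<forall>y\<in>S. (x, y) \<in> (star_step \<inter> S \<times> S)\<^sup>*)"

text \<open>Deleting the star leaves the nonzero places sorted by their letters, which is exactly
  the cyclic order type.\<close>

definition pattern :: "nat list \<Rightarrow> nat list" where
  "pattern W = filter (\<lambda>x. x \<noteq> 0) W"

definition pos :: "nat list \<Rightarrow> nat \<Rightarrow> nat" where
  "pos W a = length (takeWhile (\<lambda>b. b \<noteq> a) W)"

definition star_tuple :: "nat \<Rightarrow> nat list \<Rightarrow> nat list" where
  "star_tuple m W = map (\<lambda>p. if p = 0 then 0 else Suc (pos W p)) [0..<Suc m]"

lemma pos_less: "a \<in> set W \<Longrightarrow> pos W a < length W"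
  unfolding pos_def by (induction W) auto

lemma nth_pos: "a \<in> set W \<Longrightarrow> W ! pos W a = a"
  unfolding pos_def by (induction W) auto

lemma pos_nth: "distinct W \<Longrightarrow> i < length W \<Longrightarrow> pos W (W ! i) = i"
  by (metis nth_eq_iff_index_eq nth_mem nth_pos pos_less)

lemma inj_on_pos: "inj_on (pos W) (set W)"
  by (metis inj_onI nth_pos)

lemma pos_map_transpose:
  "pos (map (swap 0 a) W) b = pos W (swap 0 a b)"
proof -
  have "((\<lambda>x. x \<noteq> b) \<circ> swap 0 a) = (\<lambda>x. x \<noteq> swap 0 a b)"
    by (auto simp: fun_eq_iff)
  then show ?thesis by (simp add: pos_def takeWhile_map)
qed

text \<open>A pattern lists \<open>{1..m}\<close> in increasing order of \<open>pos\<close>, and a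
  strictly sorted list is determined by its set.\<close>

lemma pattern_eqI:
  assumes W: "star_word m W" and W': "star_word m W'"
    and order: "\<And>p q. p \<in> {1..m} \<Longrightarrow> q \<in> {1..m} \<Longrightarrow> pos W p < pos W q \<longleftrightarrow> pos W' p < pos W' q"
  shows "pattern W = pattern W'"
proof -
  have sorted: "sorted_wrt (\<lambda>a b. pos V a < pos V b) (pattern V)" if "distinct V" for V
    unfolding pattern_def using that
    by (intro sorted_wrt_filter) (auto simp: sorted_wrt_iff_nth_less pos_nth)
  have sets: "set (pattern V) = {1..m}" if "star_word m V" for V
    using that by (auto simp: pattern_def star_word_def)
  have "sorted_wrt (\<lambda>a b. pos W a < pos W b) (pattern W')"
    using sorted[of W'] W' order sets[OF W']
    by (auto simp: star_word_def intro: sorted_wrt_mono_rel[rotated])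
  then have "sorted_wrt (<) (map (pos W) (pattern W'))" by (simp add: sorted_wrt_map)
  moreover have "sorted_wrt (<) (map (pos W) (pattern W))"
    using sorted[of W] W by (simp add: sorted_wrt_map star_word_def)
  moreover have "set (map (pos W) (pattern W)) = set (map (pos W) (pattern W'))"
    using sets W W' by simp
  ultimately have "map (pos W) (pattern W) = map (pos W) (pattern W')"
    using strict_sorted_equal by blast
  moreover have "inj_on (pos W) (set (pattern W) \<union> set (pattern W'))"
    using inj_on_pos[of W] sets W W' by (auto simp: star_word_def intro: inj_on_subset)
  ultimately show ?thesis by (simp add: inj_on_map_eq_map)
qed

lemma length_star_word: "star_word m W \<Longrightarrow> length W = Suc m"
  unfolding star_word_def by (metis card_atLeastAtMost diff_zero distinct_card Suc_eq_plus1 add.commute)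

lemma star_tuple_nth:
  "p < Suc m \<Longrightarrow> star_tuple m W ! p = (if p = 0 then 0 else Suc (pos W p))"
  by (simp add: star_tuple_def del: upt_Suc)

lemma length_star_tuple[simp]: "length (star_tuple m W) = Suc m"
  by (simp add: star_tuple_def)

lemma distinct_star_tuple:
  assumes "star_word m W"
  shows "distinct (star_tuple m W)"
proof -
  have "pos W p \<noteq> pos W q" if "p \<noteq> q" "p < Suc m" "q < Suc m" for p q
    using inj_onD[OF inj_on_pos[of W], of p q] that assms by (auto simp: star_word_def)
  then show ?thesis by (auto simp: distinct_conv_nth star_tuple_nth)
qed

lemma set_star_tuple:
  assumes "star_word m W"
  shows "set (star_tuple m W) \<subseteq> {0..Suc m}"
proof -
  have "pos W p \<le> m" if "p \<le> m" for p
    using pos_less[of p W] that assms length_star_word[OF assms] by (simp add: star_word_def)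
  then show ?thesis by (auto simp: star_tuple_def)
qed

text \<open>The letter 0 is the minimum and sits at place 0 before rotation, so an order isomorphism
  reveals the rotation offset. Once the offsets agree, comparing the remaining letters place by
  place gives equal patterns.\<close>

lemma rotation_star_tuple_unique:
  assumes W: "star_word m W" and W': "star_word m W'"
    and k: "k < Suc m" "k' < Suc m"
    and iso: "order_isomorphic (rotate k (star_tuple m W)) (rotate k' (star_tuple m W'))"
  shows "k = k' \<and> pattern W = pattern W'"
proof -
  let ?n = "Suc m" and ?e = "rotate k (star_tuple m W)" and ?f = "rotate k' (star_tuple m W')"
  have e: "?e ! i = star_tuple m W ! ((k + i) mod ?n)" if "i < ?n" for i
    using that by (simp add: nth_rotate)
  have f: "?f ! i = star_tuple m W' ! ((k' + i) mod ?n)" if "i < ?n" for i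
    using that by (simp add: nth_rotate)
  have less: "?e ! i < ?e ! j \<longleftrightarrow> ?f ! i < ?f ! j" if "i < ?n" "j < ?n" for i j
    using iso that by (simp add: order_isomorphic_def)
  \<comment> \<open>These are the indices to which the rotations carry the letter 0; the outer
    \<open>mod\<close> covers offset 0.\<close>
  let ?z = "(?n - k) mod ?n" and ?z' = "(?n - k') mod ?n"
  have z: "?z < ?n" "?z' < ?n" by simp_all
  have shift: "(l + (?n - l + p) mod ?n) mod ?n = p" if "l < ?n" "p < ?n" for l p
  proof -
    have "(l + (?n - l + p) mod ?n) mod ?n = (l + (?n - l + p)) mod ?n" by (rule mod_add_right_eq)
    also have "l + (?n - l + p) = p + ?n" using that by linarith
    finally show ?thesis using that by (simp only: mod_add_self2 mod_less)
  qed
  have e0: "?e ! ?z = 0"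
    using e[OF z(1)] shift[OF k(1), of 0] by (simp add: star_tuple_nth)
  have f0: "?f ! ?z' = 0"
    using f[OF z(2)] shift[OF k(2), of 0] by (simp add: star_tuple_nth)
  \<comment> \<open>No letter of \<open>?e\<close> is below the one at \<open>?z\<close>, so in
    \<open>?f\<close> the letter 0 at \<open>?z'\<close> is not below the letter at
    \<open>?z\<close>.\<close>
  have "?f ! ?z = 0"
    using less[OF z(2) z(1)] e0 f0 by simp
  then have "(k' + ?z) mod ?n = 0"
    using f[OF z(1)] by (simp add: star_tuple_nth split: if_splits)
  then have "k' = k"
  proof (cases "k = 0")
    case False
    then have "(k' + (?n - k)) mod ?n = 0"
      using \<open>(k' + ?z) mod ?n = 0\<close> by simp
    \<comment> \<open>A multiple of \<open>?n\<close> strictly between 0 and twice \<open>?n\<close>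
      equals \<open>?n\<close>.\<close>
    then have "?n dvd k' + (?n - k)" by (simp add: mod_eq_0_iff_dvd)
    moreover have "0 < ?n - k" "?n - k < ?n" using k False by simp_all
    then have "0 < k' + (?n - k)" "k' + (?n - k) < ?n * 2"
      using add_strict_mono[OF k(2), of "?n - k" ?n] by simp_all
    ultimately have "k' + (?n - k) = ?n" by (elim dvdE) (auto simp only: mult_less_cancel1 less_2_cases_iff mult_0_right mult_1_right less_irrefl One_nat_def[symmetric])
    with k show ?thesis by linarith
  qed (use k in simp)
  moreover have "pos W p < pos W q \<longleftrightarrow> pos W' p < pos W' q" if pq: "p \<in> {1..m}" "q \<in> {1..m}" for p q
  proof -
    have "(?n - k + p) mod ?n < ?n" "(?n - k + q) mod ?n < ?n" by simp_all
    from less[OF this] e[OF this(1)] e[OF this(2)] f[OF this(1)] f[OF this(2)]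
    have "star_tuple m W ! p < star_tuple m W ! q \<longleftrightarrow> star_tuple m W' ! p < star_tuple m W' ! q"
      using shift[OF k(1), of p] shift[OF k(1), of q] pq \<open>k' = k\<close> by simp
    then show ?thesis using pq by (simp add: star_tuple_nth)
  qed
  ultimately show ?thesis using pattern_eqI[OF W W'] by simp
qed

section \<open>The arcs: rotations of star tuples\<close>

definition rotations :: "nat \<Rightarrow> nat list set \<Rightarrow> nat list set" where
  "rotations m T = {rotate k (star_tuple m W) | k W. W \<in> T}"

abbreviation follows :: "nat list set \<Rightarrow> (nat list \<times> nat list) set" where
  "follows A \<equiv> {(e, f) \<in> A \<times> A. tl e = butlast f}"

lemma butlast_rotate1: "butlast (rotate1 e) = tl e"
  by (cases e) auto

lemma rotations_follow_same_word:
  assumes "W \<in> T"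
  shows "(rotate k (star_tuple m W), rotate k' (star_tuple m W)) \<in> (follows (rotations m T))\<^sup>*"
proof -
  have step: "(rotate k (star_tuple m W), rotate (k + j) (star_tuple m W)) \<in> (follows (rotations m T))\<^sup>*" for j
  proof (induction j)
    case (Suc j)
    have "rotate i (star_tuple m W) \<in> rotations m T" for i using assms by (auto simp: rotations_def)
    from this[of "k + j"] this[of "k + Suc j"]
    have "(rotate (k + j) (star_tuple m W), rotate (k + Suc j) (star_tuple m W)) \<in> follows (rotations m T)"
      by (simp add: butlast_rotate1)
    with Suc.IH show ?case by (rule rtrancl_into_rtrancl)
  qed simp
  \<comment> \<open>Only forward steps are available; \<open>k' + k * m\<close> is a nonnegative
    number congruent to k' - k modulo \<open>Suc m\<close>.\<close>
  have "k + (k' + k * m) = k' + k * Suc m" by simp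
  then have "rotate (k + (k' + k * m)) (star_tuple m W) = rotate k' (star_tuple m W)"
    using rotate_conv_mod[of "k' + k * Suc m" "star_tuple m W"] rotate_conv_mod[of k' "star_tuple m W"]
    by (simp only: length_star_tuple mod_mult_self1)
  with step[of "k' + k * m"] show ?thesis by simp
qed

text \<open>The two tuples differ only at the place \<open>a\<close> whose symbol is swapped with the star, so after
  rotating this place to the front the two arcs have the same head.\<close>

lemma star_step_tuples:
  assumes "(W, W') \<in> star_step" "star_word m W"
  shows "\<exists>a. tl (rotate a (star_tuple m W)) = tl (rotate a (star_tuple m W'))"
proof -
  obtain a where a: "a \<in> set W" "W' = map (swap 0 a) W"
    using assms by (auto simp: star_step_def)
  then have "a < Suc m" using assms by (auto simp: star_word_def)
  have same: "star_tuple m W ! p = star_tuple m W' ! p" if "p < Suc m" "p \<noteq> a" for p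
    using that a(2) by (auto simp: star_tuple_nth pos_map_transpose)
  have "tl (rotate a (star_tuple m W)) = tl (rotate a (star_tuple m W'))"
  proof (rule nth_equalityI)
    fix i assume "i < length (tl (rotate a (star_tuple m W)))"
    then have i: "Suc i < Suc m" by simp
    then have "(a + Suc i) mod Suc m \<noteq> a"
      using \<open>a < Suc m\<close> by (auto simp: mod_if)
    then show "tl (rotate a (star_tuple m W)) ! i = tl (rotate a (star_tuple m W')) ! i"
      using same[of "(a + Suc i) mod Suc m"] i by (simp add: nth_tl nth_rotate)
  qed simp
  then show ?thesis ..
qed

text \<open>The rotations of one word form a closed walk, and every star step lets one cross from
  the walk of a word to that of its neighbour.\<close>

lemma rotations_connected:
  assumes words: "\<And>W. W \<in> T \<Longrightarrow> star_word m W" and linked: "linked T"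
    and e: "e \<in> rotations m T" and f: "f \<in> rotations m T"
  shows "(e, f) \<in> (follows (rotations m T))\<^sup>*"
proof -
  have rotation_mem: "rotate i (star_tuple m V) \<in> rotations m T" if "V \<in> T" for i V
    using that by (auto simp: rotations_def)
  obtain k W k' W' where e: "e = rotate k (star_tuple m W)" "W \<in> T"
    and f: "f = rotate k' (star_tuple m W')" "W' \<in> T"
    using e f by (auto simp: rotations_def)
  have "(W, W') \<in> (star_step \<inter> T \<times> T)\<^sup>*" using linked e(2) f(2) by (auto simp: linked_def)
  then have "(e, rotate k' (star_tuple m W')) \<in> (follows (rotations m T))\<^sup>*" for k'
  proof (induction arbitrary: k' rule: rtrancl_induct)
    case base
    then show ?case using rotations_follow_same_word[OF e(2)] e(1) by simp
  next
    case (step V V')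
    then have V: "(V, V') \<in> star_step" "V \<in> T" "V' \<in> T" by auto
    then obtain a where "tl (rotate a (star_tuple m V)) = tl (rotate a (star_tuple m V'))"
      using star_step_tuples words by blast
    \<comment> \<open>The crossing takes place where the changed place \<open>a\<close> is in front:
      the common tail is a vertex that both closed walks pass through.\<close>
    then have "(rotate a (star_tuple m V), rotate (Suc a) (star_tuple m V')) \<in> follows (rotations m T)"
      using rotation_mem[OF V(2), of a] rotation_mem[OF V(3), of "Suc a"]
      by (simp add: butlast_rotate1)
    moreover have "(rotate (Suc a) (star_tuple m V'), rotate k' (star_tuple m V')) \<in> (follows (rotations m T))\<^sup>*"
      by (rule rotations_follow_same_word[OF V(3)])
    ultimately show ?case
      using step.IH[of a] by (meson rtrancl_into_rtrancl rtrancl_trans)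
  qed
  with f show ?thesis by simp
qed

text \<open>Each of the m! words yields m + 1 rotations. Injectivity of the standardized rotations
  gives both the count (m + 1)! and the distinctness of the order types.\<close>

lemma universal_cycle_from_star_words:
  assumes words: "\<And>W. W \<in> T \<Longrightarrow> star_word m W" and linked: "linked T"
    and inj: "inj_on pattern T" and card: "card T = fact m"
  shows "\<exists>u :: nat list. length u = fact (Suc m) \<and> set u \<subseteq> {0..Suc m} \<and>
           (\<forall>a \<in> perm_tuples (Suc m).
              \<exists>!i. i < fact (Suc m) \<and> order_isomorphic a (cyclic_interval (Suc m) u i))"
proof (rule universal_cycle_from_arcs)
  let ?A = "rotations m T" and ?rot = "\<lambda>(k, W). rotate k (star_tuple m W)"
  have A: "?A = ?rot ` ({..<Suc m} \<times> T)"
  proof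
    show "?A \<subseteq> ?rot ` ({..<Suc m} \<times> T)"
    proof
      fix e assume "e \<in> ?A"
      then obtain k W where "e = rotate k (star_tuple m W)" "W \<in> T" by (auto simp: rotations_def)
      then have "e = ?rot (k mod Suc m, W)" "(k mod Suc m, W) \<in> {..<Suc m} \<times> T"
        using rotate_conv_mod[of k "star_tuple m W"] by auto
      then show "e \<in> ?rot ` ({..<Suc m} \<times> T)" by blast
    qed
  qed (auto simp: rotations_def)
  have inj_rank: "inj_on (rank_list \<circ> ?rot) ({..<Suc m} \<times> T)"
  proof (rule inj_onI)
    fix x y assume xy: "x \<in> {..<Suc m} \<times> T" "y \<in> {..<Suc m} \<times> T"
      and "(rank_list \<circ> ?rot) x = (rank_list \<circ> ?rot) y"
    then have eq: "rank_list (?rot x) = rank_list (?rot y)" by simp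
    obtain k W k' W' where x: "x = (k, W)" and y: "y = (k', W')" by (cases x; cases y)
    have W: "W \<in> T" "W' \<in> T" and k: "k < Suc m" "k' < Suc m" using xy x y by auto
    have "distinct (?rot x)" "distinct (?rot y)"
      using distinct_star_tuple[OF words[OF W(1)]] distinct_star_tuple[OF words[OF W(2)]] x y by auto
    from order_isomorphic_rank_list[OF this(1)] order_isomorphic_rank_list[OF this(2)]
    have "order_isomorphic (?rot x) (?rot y)"
      unfolding eq by (blast intro: order_isomorphic_sym order_isomorphic_trans)
    then have "k = k' \<and> pattern W = pattern W'"
      using rotation_star_tuple_unique[OF words[OF W(1)] words[OF W(2)] k] x y by simp
    then show "x = y" using inj_onD[OF inj] W x y by simp
  qed
  then show "inj_on rank_list ?A" unfolding A by (rule inj_on_imageI)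
  have "inj_on ?rot ({..<Suc m} \<times> T)" using inj_rank by (rule inj_on_imageI2)
  then show "card ?A = fact (Suc m)"
    unfolding A by (simp add: card_image card_cartesian_product card)
  show "length e = Suc m" "distinct e" "set e \<subseteq> {0..Suc m}" if e: "e \<in> ?A" for e
  proof -
    obtain k W where "e = rotate k (star_tuple m W)" and W: "W \<in> T"
      using e by (auto simp: rotations_def)
    with distinct_star_tuple[OF words[OF W]] set_star_tuple[OF words[OF W]]
    show "length e = Suc m" "distinct e" "set e \<subseteq> {0..Suc m}" by simp_all
  qed
  \<comment> \<open>The rotation count in \<open>rotations\<close> is unbounded, so one more
    rotation stays in the set.\<close>
  show "rotate1 e \<in> ?A" if "e \<in> ?A" for e
    using that unfolding rotations_def by (clarsimp simp del: rotate_Suc simp flip: rotate_Suc) blast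
  show "(e, f) \<in> (follows ?A)\<^sup>*" if "e \<in> ?A" "f \<in> ?A" for e f
    using rotations_connected[OF words linked that] .
qed simp

section \<open>Linked sets and ways of gluing them\<close>

lemma star_step_sym: "(x, y) \<in> star_step \<Longrightarrow> (y, x) \<in> star_step"
proof -
  assume "(x, y) \<in> star_step"
  then obtain a where a: "{0, a} \<subseteq> set x" "y = map (swap 0 a) x"
    by (auto simp: star_step_def)
  have "swap 0 a 0 \<in> set y" "swap 0 a a \<in> set y" using a by auto
  then have "{0, a} \<subseteq> set y" by simp
  moreover have "x = map (swap 0 a) y" using a(2) by simp
  ultimately show ?thesis by (auto simp: star_step_def)
qed

lemma star_stepI: "0 \<in> set x \<Longrightarrow> a \<in> set x \<Longrightarrow> y = map (swap 0 a) x \<Longrightarrow> (x, y) \<in> star_step"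
  by (auto simp: star_step_def)

lemma linked_mono_rtrancl:
  assumes "linked S" "S \<subseteq> S'" "x \<in> S" "y \<in> S"
  shows "(x, y) \<in> (star_step \<inter> S' \<times> S')\<^sup>*"
  using assms rtrancl_mono[of "star_step \<inter> S \<times> S" "star_step \<inter> S' \<times> S'"]
  by (auto simp: linked_def)

text \<open>Star steps are symmetric, so any two words are joined through the root
  \<open>r\<close>.\<close>

lemma linkedI_root:
  assumes "\<And>x. x \<in> S \<Longrightarrow> (r, x) \<in> (star_step \<inter> S \<times> S)\<^sup>*"
  shows "linked S"
proof -
  have "sym (star_step \<inter> S \<times> S)" by (auto intro!: symI star_step_sym)
  then have "sym ((star_step \<inter> S \<times> S)\<^sup>*)" by (rule sym_rtrancl)
  then have "(x, r) \<in> (star_step \<inter> S \<times> S)\<^sup>*" if "x \<in> S" for x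
    using assms[OF that] by (meson symE)
  with assms show ?thesis unfolding linked_def by (meson rtrancl_trans)
qed

text \<open>Used with \<open>r\<close> a hub having a neighbour in each of several copies.\<close>

lemma linked_UN:
  assumes C: "\<And>j. j \<in> J \<Longrightarrow> linked (C j)"
    and r: "\<And>j. j \<in> J \<Longrightarrow> \<exists>y\<in>C j. (r, y) \<in> star_step"
  shows "linked (insert r (\<Union>j\<in>J. C j))"
proof (rule linkedI_root[of _ r])
  let ?S = "insert r (\<Union>j\<in>J. C j)"
  fix x assume "x \<in> ?S"
  then consider "x = r" | j where "j \<in> J" "x \<in> C j" by blast
  then show "(r, x) \<in> (star_step \<inter> ?S \<times> ?S)\<^sup>*"
  proof cases
    case 2
    obtain y where y: "y \<in> C j" "(r, y) \<in> star_step" using r 2 by blast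
    then have "(r, y) \<in> star_step \<inter> ?S \<times> ?S" using 2 by blast
    moreover have "(y, x) \<in> (star_step \<inter> ?S \<times> ?S)\<^sup>*"
      using 2 y by (intro linked_mono_rtrancl[OF C]) auto
    ultimately show ?thesis by (rule converse_rtrancl_into_rtrancl)
  qed simp
qed

lemma linked_insert:
  assumes "linked S" "y \<in> S" "(x, y) \<in> star_step"
  shows "linked (insert x S)"
  using linked_UN[of "{()}" "\<lambda>_. S" x] assms by auto

lemma linked_Un:
  assumes S: "linked S" and S': "linked S'" and xy: "x \<in> S" "y \<in> S'" "(x, y) \<in> star_step"
  shows "linked (S \<union> S')"
proof (rule linkedI_root[of _ x])
  let ?R = "star_step \<inter> (S \<union> S') \<times> (S \<union> S')"
  fix z assume "z \<in> S \<union> S'"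
  then show "(x, z) \<in> ?R\<^sup>*"
  proof
    assume "z \<in> S"
    then show ?thesis using linked_mono_rtrancl[OF S _ xy(1)] by blast
  next
    assume "z \<in> S'"
    then have "(y, z) \<in> ?R\<^sup>*" using linked_mono_rtrancl[OF S' _ xy(2)] by blast
    moreover have "(x, y) \<in> ?R" using xy by blast
    ultimately show ?thesis by (meson converse_rtrancl_into_rtrancl)
  qed
qed

lemma linked_image:
  assumes S: "linked S"
    and f: "\<And>x y. x \<in> S \<Longrightarrow> y \<in> S \<Longrightarrow> (x, y) \<in> star_step \<Longrightarrow> (f x, f y) \<in> star_step"
  shows "linked (f ` S)"
proof -
  have "(f x, f y) \<in> (star_step \<inter> f ` S \<times> f ` S)\<^sup>*" if "(x, y) \<in> (star_step \<inter> S \<times> S)\<^sup>*" for x y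
    using that
  proof (induction rule: rtrancl_induct)
    case (step y z)
    then have "(f y, f z) \<in> star_step \<inter> f ` S \<times> f ` S" using f by blast
    with step.IH show ?case by (rule rtrancl_into_rtrancl)
  qed simp
  with S show ?thesis by (auto simp: linked_def)
qed

text \<open>An injective renaming that fixes the star turns the swap with \<open>a\<close> into the
  swap with \<open>f a\<close>. The appended symbol is neither the star nor a renamed symbol, so it
  stays put.\<close>

lemma star_step_relabel:
  assumes step: "(x, y) \<in> star_step" and inj: "inj_on f (set x)" and f0: "f 0 = 0"
    and i: "i \<noteq> 0" "i \<notin> f ` set x"
  shows "(map f x @ [i], map f y @ [i]) \<in> star_step"
proof -
  obtain a where a: "0 \<in> set x" "a \<in> set x" "y = map (swap 0 a) x"
    using step by (auto simp: star_step_def)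
  have "f (swap 0 a b) = swap 0 (f a) (f b)" if "b \<in> set x" for b
    using inj_onD[OF inj _ that a(2)] inj_onD[OF inj _ that a(1)] f0
    by (auto simp: Transposition.transpose_def)
  then have "map f y @ [i] = map (swap 0 (f a)) (map f x @ [i])"
    using a i by (auto simp: Transposition.transpose_def)
  moreover have "0 \<in> set (map f x @ [i])" "f a \<in> set (map f x @ [i])"
    using a f0 by (auto simp: image_iff intro: bexI[of _ 0])
  ultimately show ?thesis by (intro star_stepI)
qed

section \<open>Connected systems of star words\<close>

text \<open>The distinguished words agree on the block 4, ..., m, so a renaming that fixes this
  block acts on the four parameters only.\<close>

definition core :: "nat \<Rightarrow> nat \<Rightarrow> nat \<Rightarrow> nat \<Rightarrow> nat \<Rightarrow> nat list" where
  "core m a b c d = [a, b, c] @ [4..<Suc m] @ [d]"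

text \<open>The words for which \<open>free_labels\<close> asks only need to have the star at index \<open>j - 1\<close>. Places
  can be renamed freely in each copy of \<open>T\<close>, so nothing else about them matters.\<close>

definition free_labels :: "nat \<Rightarrow> nat set" where
  "free_labels m = insert 2 {4..m}"

text \<open>The induction invariant. Linkedness is demanded without \<open>core m 1 2 3 0\<close>,
  because the inductive step replaces the image of this word in three copies. The other four listed
  words provide the neighbours of the replacements.\<close>

definition good :: "nat \<Rightarrow> nat list set \<Rightarrow> bool" where
  "good m T \<longleftrightarrow>
     (\<forall>W\<in>T. star_word m W) \<and> inj_on pattern T \<and> card T = fact m \<and>
     {core m 1 2 3 0, core m 0 2 3 1, core m 1 2 0 3, core m 3 2 0 1, core m 0 2 1 3} \<subseteq> T \<and>
     linked (T - {core m 1 2 3 0}) \<and>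
     (\<forall>j\<in>free_labels m. \<exists>W\<in>T. W ! (j - 1) = 0)"

section \<open>Base case m = 4\<close>

fun grows :: "nat list list \<Rightarrow> bool" where
  "grows [] \<longleftrightarrow> True"
| "grows (W # Ws) \<longleftrightarrow> (Ws = [] \<or> 0 \<in> set W \<and>
     list_ex (\<lambda>a. map (swap 0 a) W \<in> set Ws) W) \<and> grows Ws"

text \<open>Reading the list from its end, each new word is attached to one already present, so
  \<open>grows\<close> is an executable certificate of connectedness.\<close>

lemma grows_linked: "grows Ws \<Longrightarrow> linked (set Ws)"
proof (induction Ws)
  case (Cons W Ws)
  show ?case
  proof (cases "Ws = []")
    case False
    with Cons obtain a where "0 \<in> set W" "a \<in> set W" "map (swap 0 a) W \<in> set Ws"
      by (auto simp: list_ex_iff)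
    moreover from this have "(W, map (swap 0 a) W) \<in> star_step"
      by (intro star_stepI[of W a]) simp_all
    moreover have "linked (set Ws)" using Cons by simp
    ultimately show ?thesis using linked_insert by simp
  qed (simp add: linked_def)
qed (simp add: linked_def)

text \<open>Together with \<open>core 4 1 2 3 0\<close> these 23 words represent all 4! patterns;
  their order is the one that \<open>grows\<close> checks.\<close>

definition base_words :: "nat list list" where
  "base_words = [[4, 3, 0, 2, 1], [4, 3, 1, 2, 0], [0, 4, 2, 3, 1], [4, 0, 1, 2, 3],
     [4, 2, 1, 0, 3], [0, 3, 4, 2, 1], [1, 0, 4, 2, 3], [1, 3, 4, 2, 0], [1, 3, 0, 2, 4],
     [0, 3, 1, 2, 4], [2, 4, 0, 3, 1], [2, 3, 1, 0, 4], [2, 0, 1, 3, 4], [2, 4, 1, 3, 0],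
     [1, 4, 0, 3, 2], [0, 4, 1, 3, 2], [3, 4, 1, 0, 2], [3, 0, 1, 4, 2], [1, 2, 0, 4, 3],
     [0, 2, 1, 4, 3], [3, 2, 1, 4, 0], [3, 2, 0, 4, 1], [0, 2, 3, 4, 1]]"

lemma good_4: "good 4 (set ([1, 2, 3, 4, 0] # base_words))"
proof -
  let ?L = "[1, 2, 3, 4, 0] # base_words"
  have "list_all (\<lambda>W. distinct W \<and> set W = set [0..<5]) ?L" by code_simp
  moreover have "set [0..<5] = {0..4 :: nat}" by auto
  ultimately have "star_word 4 W" if "W \<in> set ?L" for W
    using that unfolding list_all_iff star_word_def by metis
  moreover have patterns: "distinct (map pattern ?L)" by code_simp
  then have "inj_on pattern (set ?L)" by (simp only: distinct_map)
  moreover have "distinct ?L" using patterns by (simp only: distinct_map)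
  then have "card (set ?L) = length ?L" by (rule distinct_card)
  then have "card (set ?L) = fact 4" by (simp add: base_words_def fact_numeral)
  moreover have "{core 4 1 2 3 0, core 4 0 2 3 1, core 4 1 2 0 3, core 4 3 2 0 1, core 4 0 2 1 3} \<subseteq> set ?L"
    by code_simp
  moreover have "grows base_words" by code_simp
  then have "linked (set base_words)" by (rule grows_linked)
  moreover have "core 4 1 2 3 0 = [1, 2, 3, 4, 0]" by code_simp
  moreover have "[1, 2, 3, 4, 0] \<notin> set base_words" by code_simp
  then have "set ?L - {[1, 2, 3, 4, 0]} = set base_words" by simp
  moreover have "list_all (\<lambda>j. list_ex (\<lambda>W. W ! (j - 1) = 0) ?L) [2, 4]" by code_simp
  then have "\<forall>j\<in>free_labels 4. \<exists>W\<in>set ?L. W ! (j - 1) = 0"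
    by (simp only: free_labels_def list_all_iff list_ex_iff) auto
  ultimately show ?thesis by (simp only: good_def) blast
qed

section \<open>Renamings and core words\<close>

lemma relabelling_exists:
  fixes v w :: "nat list"
  assumes "distinct v" "length v = length w"
  shows "\<exists>f. map f v = w"
proof
  show "map (\<lambda>x. w ! pos v x) v = w"
    using assms by (intro nth_equalityI) (auto simp: pos_nth)
qed

lemma pattern_map:
  assumes "inj_on f (set w)" "0 \<in> set w" "f 0 = 0"
  shows "pattern (map f w) = map f (pattern w)"
proof -
  have "f x = 0 \<longleftrightarrow> x = 0" if "x \<in> set w" for x
    using inj_onD[OF assms(1) _ that assms(2)] assms(3) by auto
  then have "filter (\<lambda>x. f x \<noteq> 0) w = filter (\<lambda>x. x \<noteq> 0) w" by (intro filter_cong) auto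
  then show ?thesis by (simp add: pattern_def filter_map o_def)
qed

lemma set_core: "4 \<le> Suc m \<Longrightarrow> set (core m a b c d) = {a, b, c, d} \<union> {4..m}"
  by (auto simp: core_def)

lemma core_Suc: "4 \<le> Suc m \<Longrightarrow> core (Suc m) a b c d = [a, b, c] @ [4..<Suc m] @ [Suc m, d]"
  by (simp add: core_def upt_Suc[of 4 "Suc m"] del: upt_Suc)

lemma map_core:
  "(\<And>x. x \<in> {4..m} \<Longrightarrow> f x = x) \<Longrightarrow> map f (core m a b c d) = core m (f a) (f b) (f c) (f d)"
  by (auto simp: core_def intro!: map_idI simp del: upt_Suc)

lemma map_swap_core:
  "x \<notin> {4..m} \<Longrightarrow> map (swap 0 x) (core m a b c d) =
     core m (swap 0 x a) (swap 0 x b) (swap 0 x c) (swap 0 x d)"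
  by (rule map_core) (auto simp: Transposition.transpose_def)

lemma length_core: "4 \<le> Suc m \<Longrightarrow> length (core m a b c d) = Suc m"
  by (auto simp: core_def simp del: upt_Suc)

text \<open>This explains the index \<open>j - 1\<close> in \<open>good\<close>: swapping the star
  with \<open>j\<close> in such a word puts the star there.\<close>

lemma core_nth_free_label:
  assumes "j \<in> free_labels m" "4 \<le> m"
  shows "core m a 2 c d ! (j - 1) = j"
proof (cases "j = 2")
  case False
  then have j: "4 \<le> j" "j \<le> m" using assms by (auto simp: free_labels_def)
  then obtain i where i: "j = 4 + i" by (auto simp: le_iff_add)
  have "i < m - 3" using i j by arith
  have idx: "j - 1 = length [a, 2, c] + i" using i by simp
  have "([4..<Suc m] @ [d]) ! i = j"
    using i j \<open>i < m - 3\<close> by (simp add: nth_append del: upt_Suc)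
  then show ?thesis unfolding idx core_def nth_append_length_plus .
qed (simp add: core_def)

lemma distinct_core:
  "4 \<le> Suc m \<Longrightarrow> distinct [a, b, c, d] \<Longrightarrow> {a, b, c, d} \<inter> {4..m} = {} \<Longrightarrow> distinct (core m a b c d)"
  by (auto simp: core_def)

lemma star_word_append:
  assumes w: "star_word m w" and inj: "inj_on f {0..m}" and img: "f ` {0..m} = {0..Suc m} - {i}"
    and i: "i \<in> {1..Suc m}"
  shows "star_word (Suc m) (map f w @ [i])"
proof -
  have "set (map f w) = {0..Suc m} - {i}" using w img by (simp add: star_word_def)
  then show ?thesis using w inj i by (auto simp: star_word_def distinct_map)
qed

lemma star_word_hub:
  assumes inj: "inj_on f {0..m}" and img: "f ` {0..m} = {0..Suc m} - {i}" and f0: "f 0 = 0"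
    and i: "i \<in> {1..Suc m}"
  shows "star_word (Suc m) (map f [1..<Suc m] @ [i, 0])"
proof -
  have "{0..m} - {0} = {1..m}" by auto
  then have "f ` {1..m} = f ` {0..m} - f ` {0}"
    using inj_on_image_set_diff[OF inj, of "{0..m}" "{0}"] by simp
  then have img': "f ` {1..m} = {1..Suc m} - {i}" using img f0 by auto
  have sets: "set (map f [1..<Suc m]) = {1..Suc m} - {i}"
    using img' by (simp add: atLeastLessThanSuc_atLeastAtMost del: upt_Suc)
  have "inj_on f {1..m}" using inj by (rule inj_on_subset) auto
  then have "distinct (map f [1..<Suc m])"
    by (simp add: distinct_map atLeastLessThanSuc_atLeastAtMost del: upt_Suc)
  with sets i show ?thesis unfolding star_word_def by (auto simp del: upt_Suc)
qed

section \<open>Inductive step from m to m + 1\<close>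

lemma pattern_append: "pattern (v @ w) = pattern v @ pattern w"
  by (simp add: pattern_def)

text \<open>Swapping the star with 3 reattaches the exceptional word to
  \<open>core m 1 2 0 3\<close>.\<close>

lemma good_linked:
  assumes good: "good m T" and m: "4 \<le> m"
  shows "linked T"
proof -
  have "(core m 1 2 3 0, core m 1 2 0 3) \<in> star_step"
    using m by (intro star_stepI[of _ 3]) (auto simp: set_core map_swap_core)
  moreover have "core m 1 2 3 0 \<noteq> core m 1 2 0 3" by (simp add: core_def)
  ultimately have "linked (insert (core m 1 2 3 0) (T - {core m 1 2 3 0}))"
    using good by (intro linked_insert[of _ "core m 1 2 0 3"]) (auto simp: good_def)
  then show ?thesis using good by (simp add: good_def insert_absorb)
qed

text \<open>Words of copy \<open>i\<close> end in \<open>i\<close>, and one star step cannot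
  exchange two nonzero last symbols, so distinct copies are joined only through words ending in the
  star. Of the three such words, \<open>hub 3\<close> joins all copies but 3, \<open>hub 1\<close>
  attaches copy 3, and \<open>hub M\<close> becomes the exceptional word of the new system.\<close>

lemma good_Suc:
  assumes good: "good m T" and m: "4 \<le> m"
  shows "\<exists>T'. good (Suc m) T'"
proof -
  define M where "M = Suc m"
  define l where "l = core m 1 2 3 0"
  have words: "star_word m W" if "W \<in> T" for W using good that by (simp add: good_def)
  have inj_T: "inj_on pattern T" and card_T: "card T = fact m"
    and l: "l \<in> T" and linked_Tl: "linked (T - {l})"
    and mem: "core m 0 2 3 1 \<in> T - {l}" "core m 1 2 0 3 \<in> T - {l}"
      "core m 3 2 0 1 \<in> T - {l}" "core m 0 2 1 3 \<in> T - {l}"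
    and free: "\<And>j. j \<in> free_labels m \<Longrightarrow> \<exists>W\<in>T. W ! (j - 1) = 0"
    using good by (auto simp: good_def l_def core_def)
  have linked_T: "linked T" using good_linked[OF good m] .
  have labels: "{1..M} = insert 1 (insert 3 (insert M (free_labels m)))"
    using m by (auto simp: free_labels_def M_def)
  have free_sub: "j \<le> m" "0 < j" "j \<noteq> 1" "j \<noteq> 3" "j \<noteq> M" if "j \<in> free_labels m" for j
    using that m by (auto simp: free_labels_def M_def)

  \<comment> \<open>The word \<open>core m 1 2 M 3 @ [0]\<close> will be \<open>hub 3\<close>, and
    copy \<open>j\<close> has to contain its neighbour under the swap with \<open>j\<close>. That
    neighbour has the star at index \<open>j - 1\<close>, so a word of \<open>T\<close> with the
    star there can be renamed to it with the star fixed.\<close>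
  have "\<exists>f. inj_on f {0..m} \<and> f ` {0..m} = {0..M} - {j} \<and> f 0 = 0 \<and>
           (\<exists>W\<in>T. map f W @ [j] = map (swap 0 j) (core m 1 2 M 3 @ [0]))" if j: "j \<in> free_labels m" for j
  proof -
    obtain W where W: "W \<in> T" "W ! (j - 1) = 0" using free[OF j] by blast
    let ?v = "map (swap 0 j) (core m 1 2 M 3)"
    have dist: "distinct (core m 1 2 M 3)"
      using m by (intro distinct_core) (auto simp: M_def)
    have v: "distinct ?v" using dist by (simp add: distinct_map)
    have set_v: "set ?v = {0..M} - {j}"
    proof -
      have "set (core m 1 2 M 3) = {0..M} - {0}" using m by (auto simp: set_core M_def)
      moreover have "swap 0 j ` ({0..M} - {0}) = swap 0 j ` {0..M} - {j}"
        by (simp add: image_set_diff)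
      moreover have "swap 0 j ` {0..M} = {0..M}"
        using free_sub[OF j] by (intro transpose_image_eq) (simp add: M_def)
      ultimately show ?thesis by simp
    qed
    have W': "distinct W" "set W = {0..m}" "length W = Suc m"
      using words[OF W(1)] length_star_word by (auto simp: star_word_def)
    obtain f where f: "map f W = ?v"
      using relabelling_exists[OF W'(1), of ?v] W'(3) m by (auto simp: length_core)
    have "inj_on f {0..m}" using v f W' by (metis distinct_map)
    moreover have "f ` {0..m} = {0..M} - {j}" using f set_v W'(2) by (metis list.set_map)
    moreover have "f 0 = 0"
    proof -
      have "j - 1 < Suc m" using free_sub[OF j] by simp
      then have "f (W ! (j - 1)) = ?v ! (j - 1)" using f W'(3) by (metis nth_map)
      then show ?thesis using W(2) core_nth_free_label[OF j m] \<open>j - 1 < Suc m\<close> m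
        by (simp add: length_core)
    qed
    moreover have "map f W @ [j] = map (swap 0 j) (core m 1 2 M 3 @ [0])" using f by simp
    ultimately show ?thesis using W(1) by blast
  qed
  then obtain \<psi> where \<psi>: "\<And>j. j \<in> free_labels m \<Longrightarrow> inj_on (\<psi> j) {0..m} \<and>
      \<psi> j ` {0..m} = {0..M} - {j} \<and> \<psi> j 0 = 0 \<and>
      (\<exists>W\<in>T. map (\<psi> j) W @ [j] = map (swap 0 j) (core m 1 2 M 3 @ [0]))"
    by metis

  \<comment> \<open>Copies 3 and \<open>M\<close> are mirror images. The renaming in copy 1 is chosen so that the five
    distinguished words of \<open>T\<close> supply all neighbours of the three hubs and the distinguished
    words of \<open>T'\<close>.\<close>
  define \<phi> where "\<phi> i = (if i = M then id else if i = 3 then swap 3 M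
      else if i = 1 then swap 3 M \<circ> swap 1 M else \<psi> i)" for i
  have neq: "M \<noteq> 1" "M \<noteq> 3" "M \<noteq> 0" "M \<noteq> 2" "4 \<le> M" using m by (auto simp: M_def)
  have \<phi>_simps: "\<phi> M = id" "\<phi> 3 = swap 3 M" "\<phi> 1 = swap 3 M \<circ> swap 1 M"
    "\<phi> (Suc 0) = swap 3 M \<circ> swap 1 M"
    "j \<in> free_labels m \<Longrightarrow> \<phi> j = \<psi> j" for j
    using neq free_sub[of j] by (auto simp: \<phi>_def)
  have Mm: "{0..M} - {M} = {0..m}" by (auto simp: M_def)
  have swap_M: "swap a M ` {0..m} = {0..M} - {a}" if "a \<le> M" for a
  proof -
    have "swap a M ` ({0..M} - {M}) = swap a M ` {0..M} - {a}" by (simp add: image_set_diff)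
    also have "swap a M ` {0..M} = {0..M}" using that by (intro transpose_image_eq) simp
    finally show ?thesis by (simp only: Mm)
  qed
  have \<phi>: "inj_on (\<phi> i) {0..m}" "\<phi> i ` {0..m} = {0..M} - {i}" "\<phi> i 0 = 0" if "i \<in> {1..M}" for i
  proof -
    have "inj_on (\<phi> i) {0..m} \<and> \<phi> i ` {0..m} = {0..M} - {i} \<and> \<phi> i 0 = 0"
    proof -
      consider "i = 1" | "i = 3" | "i = M" | "i \<in> free_labels m" using \<open>i \<in> {1..M}\<close> labels by blast
      then show ?thesis
      proof cases
        case 1
        have "swap 3 M ` ({0..M} - {1}) = swap 3 M ` {0..M} - {1}"
          using neq by (simp add: image_set_diff)
        also have "swap 3 M ` {0..M} = {0..M}" using neq by (intro transpose_image_eq) auto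
        finally have "\<phi> 1 ` {0..m} = {0..M} - {1}"
          using neq by (simp only: \<phi>_simps image_comp[symmetric] swap_M)
        moreover have "inj_on (\<phi> 1) {0..m}"
          unfolding \<phi>_simps by (intro comp_inj_on) simp_all
        ultimately show ?thesis using 1 neq by (simp add: \<phi>_simps)
      next
        case 2
        then show ?thesis using neq swap_M[of 3] by (simp add: \<phi>_simps)
      next
        case 3
        then show ?thesis by (simp add: \<phi>_simps Mm)
      next
        case 4
        then show ?thesis using \<psi> \<phi>_simps by simp
      qed
    qed
    then show "inj_on (\<phi> i) {0..m}" "\<phi> i ` {0..m} = {0..M} - {i}" "\<phi> i 0 = 0" by auto
  qed

  \<comment> \<open>In the copies \<open>i \<in> D\<close> the image of \<open>l\<close> gives way to \<open>hub i\<close>, the word with the same pattern but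
    the star moved behind \<open>i\<close>. The star of a hub can be swapped into several different copies.\<close>
  define hub where "hub i = map (\<phi> i) [1..<M] @ [i, 0]" for i
  define D where "D = {1, 3, M}"
  define C where "C i = (\<lambda>w. map (\<phi> i) w @ [i]) ` (if i \<in> D then T - {l} else T)" for i
  define g where "g = (\<lambda>(i, w). if i \<in> D \<and> w = l then hub i else map (\<phi> i) w @ [i])"
  define T' where "T' = g ` ({1..M} \<times> T)"
  have D: "D \<subseteq> {1..M}" using labels by (auto simp: D_def)
  \<comment> \<open>The image under \<open>g\<close> serves counting and injectivity; the union of
    copies and hubs serves connectedness.\<close>
  have T': "T' = (\<Union>i\<in>{1..M}. C i) \<union> hub ` D"
    unfolding T'_def
  proof (intro equalityI subsetI)
    fix x assume "x \<in> g ` ({1..M} \<times> T)"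
    then obtain i w where iw: "i \<in> {1..M}" "w \<in> T" "x = g (i, w)" by auto
    show "x \<in> (\<Union>i\<in>{1..M}. C i) \<union> hub ` D"
    proof (cases "i \<in> D \<and> w = l")
      case True
      then show ?thesis using iw by (auto simp: g_def)
    next
      case False
      then have "x \<in> C i" using iw by (auto simp: g_def C_def)
      then show ?thesis using iw(1) by blast
    qed
  next
    fix x assume "x \<in> (\<Union>i\<in>{1..M}. C i) \<union> hub ` D"
    then consider i where "i \<in> {1..M}" "x \<in> C i" | i where "i \<in> D" "x = hub i" by blast
    then show "x \<in> g ` ({1..M} \<times> T)"
    proof cases
      case 1
      then obtain w where w: "w \<in> (if i \<in> D then T - {l} else T)" "x = map (\<phi> i) w @ [i]"
        by (auto simp only: C_def)
      then have "w \<in> T" "x = g (i, w)" by (auto simp: g_def split: if_splits)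
      then show ?thesis using 1 by blast
    next
      case 2
      then have "x = g (i, l)" by (simp add: g_def)
      then show ?thesis using 2 l D by blast
    qed
  qed

  have words': "star_word M W" if W: "W \<in> T'" for W
  proof -
    obtain i w where iw: "i \<in> {1..M}" "w \<in> T" "W = g (i, w)" using W by (auto simp: T'_def)
    have "star_word M (map (\<phi> i) w @ [i])" "star_word M (hub i)"
      using star_word_append[OF words[OF iw(2)]] star_word_hub \<phi>[OF iw(1)] iw(1)
      unfolding hub_def M_def by blast+
    then show ?thesis using iw(3) by (auto simp: g_def)
  qed
  have upt: "[1..<M] = [1, 2, 3] @ [4..<M]"
  proof -
    have "[1..<4 + (M - 4)] = [1..<4] @ [4..<4 + (M - 4)]" by (rule upt_add_eq_append) simp
    moreover have "4 + (M - 4) = M" using neq by simp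
    ultimately have "[1..<M] = [1..<4] @ [4..<M]" by (simp only:)
    also have "[1..<4] = [1, 2, 3 :: nat]" by code_simp
    finally show ?thesis .
  qed
  have pattern_l: "pattern l = [1..<M]"
    unfolding upt by (auto simp: pattern_def l_def core_def M_def filter_id_conv simp del: upt_Suc)
  \<comment> \<open>A hub has the pattern of the word it replaces, so one formula covers both cases.
    The last symbol then identifies the copy.\<close>
  have pattern_g: "pattern (g (i, w)) = map (\<phi> i) (pattern w) @ [i]" if iw: "i \<in> {1..M}" "w \<in> T" for i w
  proof -
    have *: "pattern (map (\<phi> i) w @ [i]) = map (\<phi> i) (pattern w) @ [i]"
      if "inj_on (\<phi> i) (set w)" "0 \<in> set w" for w
      using pattern_map[OF that \<phi>(3)[OF iw(1)]] iw(1) by (simp add: pattern_append) (simp add: pattern_def)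
    have w: "inj_on (\<phi> i) (set w)" "0 \<in> set w"
      using words[OF iw(2)] \<phi>(1)[OF iw(1)] by (auto simp: star_word_def)
    show ?thesis
    proof (cases "i \<in> D \<and> w = l")
      case True
      have "inj_on (\<phi> i) (set (0 # [1..<M]))"
        using \<phi>(1)[OF iw(1)] by (rule inj_on_subset) (auto simp: M_def)
      from pattern_map[OF this] \<phi>(3)[OF iw(1)]
      have "pattern (map (\<phi> i) (0 # [1..<M])) = map (\<phi> i) (pattern (0 # [1..<M]))" by simp
      moreover have "pattern (0 # [1..<M]) = [1..<M]" by (auto simp: pattern_def filter_id_conv)
      ultimately have "pattern (map (\<phi> i) [1..<M]) = map (\<phi> i) [1..<M]"
        using \<phi>(3)[OF iw(1)] by (simp add: pattern_def)
      then show ?thesis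
        using True pattern_l iw(1) by (simp add: g_def hub_def pattern_append) (simp add: pattern_def)
    next
      case False
      then show ?thesis using *[OF w] by (auto simp: g_def)
    qed
  qed
  have inj_g: "inj_on (pattern \<circ> g) ({1..M} \<times> T)"
  proof (rule inj_onI)
    fix x y assume xy: "x \<in> {1..M} \<times> T" "y \<in> {1..M} \<times> T" and eq: "(pattern \<circ> g) x = (pattern \<circ> g) y"
    obtain i w j v where x: "x = (i, w)" and y: "y = (j, v)" by (cases x; cases y)
    have i: "i \<in> {1..M}" and w: "w \<in> T" and j: "j \<in> {1..M}" and v: "v \<in> T" using xy x y by auto
    have "map (\<phi> i) (pattern w) @ [i] = map (\<phi> j) (pattern v) @ [j]"
      using eq x y by (simp only: o_apply pattern_g[OF i w] pattern_g[OF j v])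
    then have "map (\<phi> i) (pattern w) = map (\<phi> j) (pattern v)" and "i = j"
      unfolding append1_eq_conv by blast+
    then have maps: "map (\<phi> i) (pattern w) = map (\<phi> i) (pattern v)" by (simp only:)
    have "inj_on (\<phi> i) (set (pattern w) \<union> set (pattern v))"
      using \<phi>(1)[OF i] words[OF w] words[OF v]
      by (elim inj_on_subset) (auto simp: pattern_def star_word_def)
    then have "pattern w = pattern v" using maps by (simp add: inj_on_map_eq_map)
    then have "w = v" using inj_onD[OF inj_T] w v by blast
    with \<open>i = j\<close> x y show "x = y" by simp
  qed
  then have inj_T': "inj_on pattern T'" unfolding T'_def by (rule inj_on_imageI)
  have "inj_on g ({1..M} \<times> T)" using inj_g by (rule inj_on_imageI2)
  then have card_T': "card T' = fact M"
    unfolding T'_def by (simp add: card_image card_cartesian_product card_T M_def)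

  have linked_C: "linked (C i)" if i: "i \<in> {1..M}" for i
    unfolding C_def
  proof (rule linked_image)
    show "linked (if i \<in> D then T - {l} else T)" using linked_T linked_Tl by simp
    fix x y assume x: "x \<in> (if i \<in> D then T - {l} else T)" and "(x, y) \<in> star_step"
    have "set x = {0..m}" using x words by (auto simp: star_word_def split: if_splits)
    then show "(map (\<phi> i) x @ [i], map (\<phi> i) y @ [i]) \<in> star_step"
      using \<phi>[OF i] i \<open>(x, y) \<in> star_step\<close> by (intro star_step_relabel) auto
  qed
  \<comment> \<open>The renamings for \<open>D\<close> move only 1, 3 and \<open>M\<close>; all
    computations with them reduce to the parameters of \<open>core\<close>.\<close>
  have \<phi>_id: "\<phi> i x = x" if "x \<in> {4..m}" "i \<in> D" for i x
  proof -
    have "x \<noteq> M" "x \<noteq> 3" "x \<noteq> 1" using that(1) by (auto simp: M_def)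
    then show ?thesis using that(2) by (auto simp: D_def \<phi>_simps)
  qed
  have map_upt: "map (\<phi> i) [4..<M] = [4..<M]" if "i \<in> D" for i
    by (intro map_idI \<phi>_id that) (auto simp: M_def)
  have hub_core: "hub i = core m (\<phi> i 1) (\<phi> i 2) (\<phi> i 3) i @ [0]" if "i \<in> D" for i
    unfolding hub_def upt using map_upt[OF that] by (simp add: core_def M_def del: upt_Suc)
  have hubs: "hub M = core m 1 2 3 M @ [0]" "hub 3 = core m 1 2 M 3 @ [0]" "hub 1 = core m 3 2 M 1 @ [0]"
    using neq by (simp_all add: hub_core D_def \<phi>_simps)
  have C_core: "core m (\<phi> i a) (\<phi> i b) (\<phi> i c) (\<phi> i d) @ [i] \<in> C i"
    if "core m a b c d \<in> T - {l}" "i \<in> D" for i a b c d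
    using that map_core[of m "\<phi> i" a b c d] \<phi>_id by (auto simp: C_def image_iff intro!: bexI[of _ "core m a b c d"])
  \<comment> \<open>The first, second, fourth and sixth words are neighbours of \<open>hub 3\<close>
    or \<open>hub 1\<close>; the other four, with \<open>M\<close> as last parameter of
    \<open>core\<close>, are distinguished words of \<open>T'\<close>.\<close>
  have C_mem: "core m 1 2 0 3 @ [M] \<in> C M" "core m 3 2 0 1 @ [M] \<in> C M"
    "core m 1 2 0 M @ [3] \<in> C 3" "core m 0 2 M 1 @ [3] \<in> C 3" "core m 0 2 1 M @ [3] \<in> C 3"
    "core m 0 2 M 3 @ [1] \<in> C 1" "core m 0 2 3 M @ [1] \<in> C 1" "core m 3 2 0 M @ [1] \<in> C 1"
    using C_core[OF mem(2), of M] C_core[OF mem(3), of M]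
      C_core[OF mem(2), of 3] C_core[OF mem(1), of 3] C_core[OF mem(4), of 3]
      C_core[OF mem(1), of 1] C_core[OF mem(4), of 1] C_core[OF mem(2), of 1] neq
    by (simp_all add: D_def \<phi>_simps)
  have step: "(core m a b c d @ [e], map (swap 0 x) (core m a b c d @ [e])) \<in> star_step"
    if "0 \<in> {a, b, c, d, e}" "x \<in> {a, b, c, d, e}" for a b c d e x
    using that m by (intro star_stepI[OF _ _ refl]) (auto simp: set_core)
  have swap_core: "map (swap 0 x) (core m a b c d @ [e]) =
      core m (swap 0 x a) (swap 0 x b) (swap 0 x c) (swap 0 x d) @ [swap 0 x e]"
    if "x \<notin> {4..m}" for x a b c d e
    using map_swap_core[OF that] by simp
  have M_notin: "M \<notin> {4..m}" by (simp add: M_def)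
  \<comment> \<open>Swapping the final star with \<open>j\<close> yields a word ending in
    \<open>j\<close>. For 1 and \<open>M\<close> it is a renamed distinguished word, for free labels
    it was arranged by \<open>\<psi>\<close>. For 3 it would be the image of \<open>l\<close> that
    the hub has replaced.\<close>
  have hub3_C: "\<exists>y\<in>C j. (hub 3, y) \<in> star_step" if j: "j \<in> {1..M} - {3}" for j
  proof -
    consider "j = 1" | "j = M" | "j \<in> free_labels m" using j labels by blast
    then show ?thesis
    proof cases
      case 1
      show ?thesis
        using step[of 1 2 M 3 0 1] swap_core[of 1 1 2 M 3 0] C_mem(6) 1 neq hubs(2) by auto
    next
      case 2
      show ?thesis
        using step[of 1 2 M 3 0 M] swap_core[of M 1 2 M 3 0] C_mem(1) 2 neq hubs(2) M_notin by auto
    next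
      case 3
      then obtain W where W: "W \<in> T" "map (\<phi> j) W @ [j] = map (swap 0 j) (core m 1 2 M 3 @ [0])"
        using \<psi> \<phi>_simps by metis
      have "j \<notin> D" using free_sub[OF 3] by (simp add: D_def)
      then have "map (\<phi> j) W @ [j] \<in> C j" using W(1) by (simp add: C_def)
      moreover have "(hub 3, map (\<phi> j) W @ [j]) \<in> star_step"
        unfolding W(2) hubs using m 3 free_sub[OF 3] 
        by (intro star_stepI[OF _ _ refl]) (auto simp: set_core free_labels_def)
      ultimately show ?thesis by blast
    qed
  qed
  have hub1_C3: "(hub 1, core m 0 2 M 1 @ [3]) \<in> star_step"
    using step[of 3 2 M 1 0 3] swap_core[of 3 3 2 M 1 0] neq hubs(3) by auto
  have hub1_CM: "(hub 1, core m 3 2 0 1 @ [M]) \<in> star_step"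
    using step[of 3 2 M 1 0 M] swap_core[of M 3 2 M 1 0] neq hubs(3) M_notin by auto
  \<comment> \<open>The third hub is exactly the word that the invariant leaves out when asking for
    linkedness.\<close>
  have hub_M: "hub M = core M 1 2 3 0" using hubs(1) m by (simp add: core_Suc M_def) (simp add: core_def)
  have "linked (insert (hub 3) (\<Union>j\<in>{1..M} - {3}. C j))"
    using linked_C hub3_C by (intro linked_UN) auto
  moreover have "linked (insert (hub 1) (C 3))"
    using linked_C[of 3] C_mem(4) hub1_C3 neq by (intro linked_insert) auto
  moreover have "core m 3 2 0 1 @ [M] \<in> insert (hub 3) (\<Union>j\<in>{1..M} - {3}. C j)"
    using C_mem(2) neq by auto
  ultimately have "linked (insert (hub 3) (\<Union>j\<in>{1..M} - {3}. C j) \<union> insert (hub 1) (C 3))"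
    using linked_Un star_step_sym[OF hub1_CM] by blast
  moreover have "T' - {hub M} = insert (hub 3) (\<Union>j\<in>{1..M} - {3}. C j) \<union> insert (hub 1) (C 3)"
  proof -
    have "hub M \<notin> C i" if "i \<in> {1..M}" for i
      using that by (auto simp: C_def hub_def)
    moreover have "hub M \<noteq> hub 3" "hub M \<noteq> hub 1" using neq by (auto simp: hub_def)
    moreover have "3 \<in> {1..M}" using neq by simp
    ultimately show ?thesis unfolding T' by (auto simp: D_def)
  qed
  ultimately have linked_T': "linked (T' - {core M 1 2 3 0})" by (simp add: hub_M)

  have C_sub: "C i \<subseteq> T'" if "i \<in> {1..M}" for i using that by (auto simp: T')
  have core_M: "core m a b c M @ [d] = core M a b c d" for a b c d
    using m by (simp add: core_Suc M_def) (simp add: core_def)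
  have mem': "{core M 1 2 3 0, core M 0 2 3 1, core M 1 2 0 3, core M 3 2 0 1, core M 0 2 1 3} \<subseteq> T'"
  proof -
    have "core M 1 2 3 0 \<in> T'" using hub_M by (auto simp: T' D_def)
    moreover have "C 1 \<subseteq> T'" "C 3 \<subseteq> T'" using C_sub neq by auto
    ultimately show ?thesis using C_mem(3,5,7,8) unfolding core_M by blast
  qed
  \<comment> \<open>Copy 2 is unaltered, as 2 is not in \<open>D\<close>, and renaming and appending
    preserve the index of the star. For the new label \<open>M\<close> the word \<open>l\<close>
    serves, with its star at index m.\<close>
  have free': "\<exists>W\<in>T'. W ! (j - 1) = 0" if "j \<in> free_labels M" for j
  proof -
    have "\<exists>W\<in>T. W ! (j - 1) = 0"
    proof (cases "j = M")
      case True
      have "(([1, 2, 3] @ [4..<Suc m]) @ [0]) ! length ([1, 2, 3] @ [4..<Suc m]) = (0 :: nat)"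
        by (rule nth_append_length)
      moreover have "length ([1, 2, 3] @ [4..<Suc m]) = m" using m by (simp del: upt_Suc)
      ultimately have "l ! m = 0" by (simp only: l_def core_def append_assoc)
      with True l show ?thesis by (auto simp: M_def)
    next
      case False
      then show ?thesis using free[of j] \<open>j \<in> free_labels M\<close> by (auto simp: free_labels_def M_def)
    qed
    then obtain W where W: "W \<in> T" "W ! (j - 1) = 0" by blast
    have "j - 1 < length W"
      using that m length_star_word[OF words[OF W(1)]] by (auto simp: free_labels_def M_def)
    then have "(map (\<phi> 2) W @ [2]) ! (j - 1) = 0"
      using W(2) \<phi>(3)[of 2] neq by (simp add: nth_append)
    moreover have "map (\<phi> 2) W @ [2] \<in> C 2"
      using W(1) neq by (auto simp: C_def D_def)
    then have "map (\<phi> 2) W @ [2] \<in> T'" using C_sub[of 2] neq by auto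
    ultimately show ?thesis by blast
  qed
  have "good M T'"
    unfolding good_def using words' inj_T' card_T' mem' linked_T' free' by blast
  then show ?thesis unfolding M_def by blast
qed

lemma good_exists: "4 \<le> m \<Longrightarrow> \<exists>T. good m T"
  by (induction m rule: dec_induct) (use good_4 good_Suc in blast)+

theorem theorem1:
  fixes n :: nat
  assumes "n \<ge> 3"
  shows "\<exists>u :: nat list. length u = fact n \<and> set u \<subseteq> {0..n} \<and>
           (\<forall>a \<in> perm_tuples n.
              \<exists>!i. i < fact n \<and> order_isomorphic a (cyclic_interval n u i))"
proof -
  have "n = 3 \<or> n = 4 \<or> (\<exists>m. n = Suc m \<and> 4 \<le> m)" using assms by presburger
  then consider "n = 3" | "n = 4" | m where "n = Suc m" "4 \<le> m" by blast
  then show ?thesis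
  proof cases
    case 1
    then show ?thesis using universal_cycle_3 by simp
  next
    case 2
    then show ?thesis using universal_cycle_4 by simp
  next
    case 3
    obtain T where T: "good m T" using good_exists[OF 3(2)] by blast
    show ?thesis
      unfolding 3(1)
      using T good_linked[OF T 3(2)] by (intro universal_cycle_from_star_words) (auto simp: good_def)
  qed
qed

end
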